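(* Let $\mathbf{R}$ be a finite-dimensional associative unital algebra over a field $\mathbf{K}$, with tensor bialgebra $T(\mathbf{R})$. For every family of invertible elements $\Phi^{1,k}\in \mathbf{R}\otimes\mathbf{R}^{\otimes k}$, $k\ge 1$, there exists a unique invertible normalized solution $\Phi\in T(\mathbf{R})\otimes T(\mathbf{R})$ of the twisting equation $$(\Delta\otimes \mathrm{id})(\Phi)\,\Phi_{12}=(\mathrm{id}\otimes\Delta)(\Phi)\,\Phi_{23}$$ such that $(\pi^1\otimes\pi^k)(\Phi)=\Phi^{1,k}$ for all $k\ge1$.
   Context: The tensor bialgebra: $T(\mathbf{R})=\prod_{n\ge 0}\mathbf{R}^{\otimes n}$ (the full dual of the free algebra $F(\mathbf{R})$ on $\mathbf{R}^*$), with $\mathbf{R}^{\otimes 0}=\mathbf{K}$. The multiplication is componentwise: each $\mathbf{R}^{\otimes n}$ carries its tensor-product algebra structure with unit $e^n$, one has $\mathbf{R}^{\otimes n}\mathbf{R}^{\otimes m}=0$ for $n\ne m$, and the unit is $1=\sum_{n\ge0}e^n$. The projections $\pi^n\colon T(\mathbf{R})\to\mathbf{R}^{\otimes n}$ are algebra homomorphisms, and the counit is $\varepsilon=\pi^0$. The coproduct is deconcatenation: for $y_1,\dots,y_n\in\mathbf{R}$, $$\Delta(y_1\otimes\cdots\otimes y_n)=\sum_{k=0}^{n}(y_1\otimes\cdots\otimes y_k)\otimes(y_{k+1}\otimes\cdots\otimes y_n),$$ where the empty products are $e^0$. Tensor products are understood as completed: $T(\mathbf{R})\otimes T(\mathbf{R})=\prod_{m,n\ge0}\mathbf{R}^{\otimes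 m}\otimes\mathbf{R}^{\otimes n}$, and similarly for the triple tensor product, in which the twisting equation is written. Thus the $(m,n,k)$ component of $(\Delta\otimes\mathrm{id})(\Phi)$ is $(\pi^{m+n}\otimes\pi^k)(\Phi)$ viewed in $\mathbf{R}^{\otimes(m+n+k)}$, and that of $(\mathrm{id}\otimes\Delta)(\Phi)$ is $(\pi^m\otimes\pi^{n+k})(\Phi)$. $\Phi_{12}=\Phi\otimes1$ and $\Phi_{23}=1\otimes\Phi$. Normalized means $(\varepsilon\otimes\mathrm{id})(\Phi)=(\mathrm{id}\otimes\varepsilon)(\Phi)=1$. *)

theory Defs
  imports "HOL-Library.Poly_Mapping" "HOL.Vector_Spaces" "HOL-Algebra.Ring"
begin

section \<open>Finite-dimensional associative unital algebras\<close>

text \<open>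
  The sort \<open>{ring, monoid_mult}\<close> is used instead of \<open>ring_1\<close> because the latter excludes the
  zero algebra.
\<close>

locale unital_algebra = vector_space scale
  for scale :: "'k::field \<Rightarrow> 'a::{ring,monoid_mult} \<Rightarrow> 'a" +
  assumes scale_mult_left: "scale c x * y = scale c (x * y)"
    and scale_mult_right: "x * scale c y = scale c (x * y)"

locale finite_dimensional_unital_algebra = unital_algebra scale
  for scale :: "'k::field \<Rightarrow> 'a::{ring,monoid_mult} \<Rightarrow> 'a" +
  assumes finite_dimensional: "\<exists>B. finite_dimensional_vector_space scale B"


section \<open>Tensor powers\<close>

subsection \<open>The free vector space on words\<close>

text \<open>
  The tensor powers of an algebra \<open>'a\<close> over \<open>'k\<close> are realised as quotients of the free
  \<open>'k\<close>-vector space on words over \<open>'a\<close>: the word \<open>[y\<^sub>1, \<dots>, y\<^sub>n]\<close> stands for the elementary tensor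
  \<open>y\<^sub>1 \<otimes> \<dots> \<otimes> y\<^sub>n\<close>, and one divides by the relations of multilinearity.
\<close>

definition free_scale :: "'k \<Rightarrow> ('x \<Rightarrow>\<^sub>0 'k) \<Rightarrow> ('x \<Rightarrow>\<^sub>0 'k::field)" where
  "free_scale c = Poly_Mapping.map ((*) c)"

lemma lookup_free_scale [simp]: "Poly_Mapping.lookup (free_scale c p) x = c * Poly_Mapping.lookup p x"
  by (simp add: free_scale_def map.rep_eq when_def)

global_interpretation free: vector_space free_scale
  by unfold_locales
    (auto intro!: poly_mapping_eqI simp: lookup_add algebra_simps)

definition multilinear_relations ::
    "('k::field \<Rightarrow> 'a::{ring,monoid_mult} \<Rightarrow> 'a) \<Rightarrow> ('a list \<Rightarrow>\<^sub>0 'k) set" where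
  "multilinear_relations s =
     {Poly_Mapping.single (xs @ [a + b] @ ys) 1
        - Poly_Mapping.single (xs @ [a] @ ys) 1 - Poly_Mapping.single (xs @ [b] @ ys) 1
      | xs a b ys. True} \<union>
     {Poly_Mapping.single (xs @ [s c a] @ ys) 1 - free_scale c (Poly_Mapping.single (xs @ [a] @ ys) 1)
      | xs c a ys. True}"

definition tensor_rel ::
    "('k::field \<Rightarrow> 'a::{ring,monoid_mult} \<Rightarrow> 'a) \<Rightarrow> (('a list \<Rightarrow>\<^sub>0 'k) \<times> ('a list \<Rightarrow>\<^sub>0 'k)) set" where
  "tensor_rel s = {(p, q). p - q \<in> free.span (multilinear_relations s)}"

type_synonym ('a, 'k) tensor = "('a list \<Rightarrow>\<^sub>0 'k) set"

definition tensor_class ::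
    "('k::field \<Rightarrow> 'a::{ring,monoid_mult} \<Rightarrow> 'a) \<Rightarrow> ('a list \<Rightarrow>\<^sub>0 'k) \<Rightarrow> ('a, 'k) tensor" where
  "tensor_class s p = tensor_rel s `` {p}"

text \<open>\<open>y\<^sub>1 \<otimes> \<dots> \<otimes> y\<^sub>n\<close>\<close>

definition pure_tensor ::
    "('k::field \<Rightarrow> 'a::{ring,monoid_mult} \<Rightarrow> 'a) \<Rightarrow> 'a list \<Rightarrow> ('a, 'k) tensor" where
  "pure_tensor s ys = tensor_class s (Poly_Mapping.single ys 1)"

subsection \<open>Operations on representatives and on classes\<close>

definition bilinear_extension ::
    "('x \<Rightarrow> 'y \<Rightarrow> ('z \<Rightarrow>\<^sub>0 'k)) \<Rightarrow> ('x \<Rightarrow>\<^sub>0 'k) \<Rightarrow> ('y \<Rightarrow>\<^sub>0 'k) \<Rightarrow> ('z \<Rightarrow>\<^sub>0 'k::field)" where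
  "bilinear_extension b p q =
     (\<Sum>x\<in>Poly_Mapping.keys p. \<Sum>y\<in>Poly_Mapping.keys q.
        free_scale (Poly_Mapping.lookup p x * Poly_Mapping.lookup q y) (b x y))"

text \<open>
  \<open>(x\<^sub>1 \<otimes> \<dots> \<otimes> x\<^sub>n) (y\<^sub>1 \<otimes> \<dots> \<otimes> y\<^sub>n) = x\<^sub>1 y\<^sub>1 \<otimes> \<dots> \<otimes> x\<^sub>n y\<^sub>n\<close>, while products of words of
  different lengths vanish.
\<close>

definition free_mult ::
    "('a::{ring,monoid_mult} list \<Rightarrow>\<^sub>0 'k::field) \<Rightarrow> ('a list \<Rightarrow>\<^sub>0 'k) \<Rightarrow> ('a list \<Rightarrow>\<^sub>0 'k)" where
  "free_mult = bilinear_extension (\<lambda>xs ys.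
     if length xs = length ys then Poly_Mapping.single (map2 (*) xs ys) 1 else 0)"

definition free_concat ::
    "('a::{ring,monoid_mult} list \<Rightarrow>\<^sub>0 'k::field) \<Rightarrow> ('a list \<Rightarrow>\<^sub>0 'k) \<Rightarrow> ('a list \<Rightarrow>\<^sub>0 'k)" where
  "free_concat = bilinear_extension (\<lambda>xs ys. Poly_Mapping.single (xs @ ys) 1)"

definition tensor_add ::
    "('k::field \<Rightarrow> 'a::{ring,monoid_mult} \<Rightarrow> 'a) \<Rightarrow> ('a, 'k) tensor \<Rightarrow> ('a, 'k) tensor \<Rightarrow> ('a, 'k) tensor" where
  "tensor_add s A B = (\<Union>p\<in>A. \<Union>q\<in>B. tensor_class s (p + q))"

definition tensor_mult ::
    "('k::field \<Rightarrow> 'a::{ring,monoid_mult} \<Rightarrow> 'a) \<Rightarrow> ('a, 'k) tensor \<Rightarrow> ('a, 'k) tensor \<Rightarrow> ('a, 'k) tensor" where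
  "tensor_mult s A B = (\<Union>p\<in>A. \<Union>q\<in>B. tensor_class s (free_mult p q))"

text \<open>
  The canonical map \<open>R\<^sup>\<otimes>\<^sup>m \<times> R\<^sup>\<otimes>\<^sup>n \<rightarrow> R\<^sup>\<otimes>\<^sup>(\<^sup>m\<^sup>+\<^sup>n\<^sup>)\<close>, \<open>(u, v) \<mapsto> u \<otimes> v\<close>.
\<close>

definition tensor_concat ::
    "('k::field \<Rightarrow> 'a::{ring,monoid_mult} \<Rightarrow> 'a) \<Rightarrow> ('a, 'k) tensor \<Rightarrow> ('a, 'k) tensor \<Rightarrow> ('a, 'k) tensor" where
  "tensor_concat s A B = (\<Union>p\<in>A. \<Union>q\<in>B. tensor_class s (free_concat p q))"

text \<open>
  The algebra \<open>R\<^sup>\<otimes>\<^sup>n\<close>. The relations are homogeneous for the length of words, so the degree \<open>n\<close>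
  part of the quotient is the quotient of the span of the words of length \<open>n\<close> by the
  multilinear relations among them. For \<open>n = 0\<close> there are none, and one gets the field \<open>'k\<close>.
\<close>

definition tensor_power ::
    "('k::field \<Rightarrow> 'a::{ring,monoid_mult} \<Rightarrow> 'a) \<Rightarrow> nat \<Rightarrow> ('a, 'k) tensor ring" where
  "tensor_power s n =
     \<lparr>carrier = {p. Poly_Mapping.keys p \<subseteq> {ys. length ys = n}} // tensor_rel s,
      mult = tensor_mult s,
      one = pure_tensor s (replicate n 1),
      zero = tensor_class s 0,
      add = tensor_add s\<rparr>"


section \<open>The tensor bialgebra and its completed tensor powers\<close>

definition ring_prod :: "('i \<Rightarrow> 'b ring) \<Rightarrow> ('i \<Rightarrow> 'b) ring" where
  "ring_prod A =
     \<lparr>carrier = {f. \<forall>i. f i \<in> carrier (A i)},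
      mult = (\<lambda>f g i. f i \<otimes>\<^bsub>A i\<^esub> g i),
      one = (\<lambda>i. \<one>\<^bsub>A i\<^esub>),
      zero = (\<lambda>i. \<zero>\<^bsub>A i\<^esub>),
      add = (\<lambda>f g i. f i \<oplus>\<^bsub>A i\<^esub> g i)\<rparr>"

text \<open>
  \<open>T(R)\<close> is the product of all \<open>R\<^sup>\<otimes>\<^sup>n\<close>. In the completed tensor square and cube the factors
  \<open>R\<^sup>\<otimes>\<^sup>m \<otimes> R\<^sup>\<otimes>\<^sup>n\<close> and \<open>R\<^sup>\<otimes>\<^sup>m \<otimes> R\<^sup>\<otimes>\<^sup>n \<otimes> R\<^sup>\<otimes>\<^sup>k\<close> are identified with \<open>R\<^sup>\<otimes>\<^sup>(\<^sup>m\<^sup>+\<^sup>n\<^sup>)\<close> and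
  \<open>R\<^sup>\<otimes>\<^sup>(\<^sup>m\<^sup>+\<^sup>n\<^sup>+\<^sup>k\<^sup>)\<close> by concatenation of words; this includes \<open>K \<otimes> R\<^sup>\<otimes>\<^sup>n = R\<^sup>\<otimes>\<^sup>n\<close>.
\<close>

definition tensor_bialgebra ::
    "('k::field \<Rightarrow> 'a::{ring,monoid_mult} \<Rightarrow> 'a) \<Rightarrow> (nat \<Rightarrow> ('a, 'k) tensor) ring" where
  "tensor_bialgebra s = ring_prod (tensor_power s)"

definition tensor_bialgebra2 ::
    "('k::field \<Rightarrow> 'a::{ring,monoid_mult} \<Rightarrow> 'a) \<Rightarrow> (nat \<times> nat \<Rightarrow> ('a, 'k) tensor) ring" where
  "tensor_bialgebra2 s = ring_prod (\<lambda>(m, n). tensor_power s (m + n))"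

definition tensor_bialgebra3 ::
    "('k::field \<Rightarrow> 'a::{ring,monoid_mult} \<Rightarrow> 'a) \<Rightarrow> (nat \<times> nat \<times> nat \<Rightarrow> ('a, 'k) tensor) ring" where
  "tensor_bialgebra3 s = ring_prod (\<lambda>(m, n, k). tensor_power s (m + n + k))"

text \<open>\<open>\<pi>\<^sup>m \<otimes> \<pi>\<^sup>n\<close>\<close>

definition proj2 :: "nat \<Rightarrow> nat \<Rightarrow> (nat \<times> nat \<Rightarrow> 't) \<Rightarrow> 't" where
  "proj2 m n \<Phi> = \<Phi> (m, n)"

text \<open>
  Under the identification above, deconcatenation of a word of length \<open>l\<close> has the word itself
  as its component in every bidegree \<open>(m, n)\<close> with \<open>m + n = l\<close>; see \<open>deconcat_pure_tensor\<close> below.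
\<close>

definition deconcat :: "(nat \<Rightarrow> 't) \<Rightarrow> (nat \<times> nat \<Rightarrow> 't)" where
  "deconcat x = (\<lambda>(m, n). x (m + n))"

definition counit :: "(nat \<Rightarrow> 't) \<Rightarrow> 't" where
  "counit x = x 0"

text \<open>
  \<open>\<Delta> \<otimes> id\<close>, \<open>id \<otimes> \<Delta>\<close>, \<open>\<epsilon> \<otimes> id\<close>, \<open>id \<otimes> \<epsilon>\<close>: apply \<open>\<Delta>\<close> resp. \<open>\<epsilon>\<close> to one variable, the degree in the
  other one being fixed.
\<close>

definition deconcat_id :: "(nat \<times> nat \<Rightarrow> 't) \<Rightarrow> (nat \<times> nat \<times> nat \<Rightarrow> 't)" where
  "deconcat_id \<Phi> = (\<lambda>(m, n, k). deconcat (\<lambda>i. \<Phi> (i, k)) (m, n))"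

definition id_deconcat :: "(nat \<times> nat \<Rightarrow> 't) \<Rightarrow> (nat \<times> nat \<times> nat \<Rightarrow> 't)" where
  "id_deconcat \<Phi> = (\<lambda>(m, n, k). deconcat (\<lambda>i. \<Phi> (m, i)) (n, k))"

definition counit_id :: "(nat \<times> nat \<Rightarrow> 't) \<Rightarrow> (nat \<Rightarrow> 't)" where
  "counit_id \<Phi> = (\<lambda>n. counit (\<lambda>i. \<Phi> (i, n)))"

definition id_counit :: "(nat \<times> nat \<Rightarrow> 't) \<Rightarrow> (nat \<Rightarrow> 't)" where
  "id_counit \<Phi> = (\<lambda>n. counit (\<lambda>i. \<Phi> (n, i)))"

text \<open>\<open>\<Phi> \<otimes> 1\<close> and \<open>1 \<otimes> \<Phi>\<close>\<close>

definition leg12 ::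
    "('k::field \<Rightarrow> 'a::{ring,monoid_mult} \<Rightarrow> 'a) \<Rightarrow> (nat \<times> nat \<Rightarrow> ('a, 'k) tensor)
       \<Rightarrow> (nat \<times> nat \<times> nat \<Rightarrow> ('a, 'k) tensor)" where
  "leg12 s \<Phi> = (\<lambda>(m, n, k). tensor_concat s (\<Phi> (m, n)) (\<one>\<^bsub>tensor_bialgebra s\<^esub> k))"

definition leg23 ::
    "('k::field \<Rightarrow> 'a::{ring,monoid_mult} \<Rightarrow> 'a) \<Rightarrow> (nat \<times> nat \<Rightarrow> ('a, 'k) tensor)
       \<Rightarrow> (nat \<times> nat \<times> nat \<Rightarrow> ('a, 'k) tensor)" where
  "leg23 s \<Phi> = (\<lambda>(m, n, k). tensor_concat s (\<one>\<^bsub>tensor_bialgebra s\<^esub> m) (\<Phi> (n, k)))"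

definition twisting_equation ::
    "('k::field \<Rightarrow> 'a::{ring,monoid_mult} \<Rightarrow> 'a) \<Rightarrow> (nat \<times> nat \<Rightarrow> ('a, 'k) tensor) \<Rightarrow> bool" where
  "twisting_equation s \<Phi> \<longleftrightarrow>
     deconcat_id \<Phi> \<otimes>\<^bsub>tensor_bialgebra3 s\<^esub> leg12 s \<Phi> =
     id_deconcat \<Phi> \<otimes>\<^bsub>tensor_bialgebra3 s\<^esub> leg23 s \<Phi>"

definition normalized ::
    "('k::field \<Rightarrow> 'a::{ring,monoid_mult} \<Rightarrow> 'a) \<Rightarrow> (nat \<times> nat \<Rightarrow> ('a, 'k) tensor) \<Rightarrow> bool" where
  "normalized s \<Phi> \<longleftrightarrow>
     counit_id \<Phi> = \<one>\<^bsub>tensor_bialgebra s\<^esub> \<and> id_counit \<Phi> = \<one>\<^bsub>tensor_bialgebra s\<^esub>"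


section \<open>Well-definedness and characteristic formulas\<close>

lemma bilinear_extension_superset:
  assumes "finite X" "Poly_Mapping.keys p \<subseteq> X" "finite Y" "Poly_Mapping.keys q \<subseteq> Y"
  shows "bilinear_extension b p q =
    (\<Sum>x\<in>X. \<Sum>y\<in>Y. free_scale (Poly_Mapping.lookup p x * Poly_Mapping.lookup q y) (b x y))"
proof -
  have "(\<Sum>y\<in>Poly_Mapping.keys q. free_scale (Poly_Mapping.lookup p x * Poly_Mapping.lookup q y) (b x y)) =
    (\<Sum>y\<in>Y. free_scale (Poly_Mapping.lookup p x * Poly_Mapping.lookup q y) (b x y))" for x
    by (rule sum.mono_neutral_left) (use assms in \<open>auto simp: in_keys_iff\<close>)
  then show ?thesis
    unfolding bilinear_extension_def
    by (simp, intro sum.mono_neutral_left) (use assms in \<open>auto simp: in_keys_iff\<close>)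
qed

lemma bilinear_extension_single [simp]:
  "bilinear_extension b (Poly_Mapping.single x c) (Poly_Mapping.single y d) = free_scale (c * d) (b x y)"
  by (subst bilinear_extension_superset[of "{x}" _ "{y}"]) auto

lemma bilinear_extension_add_left:
  "bilinear_extension b (p + p') q = bilinear_extension b p q + bilinear_extension b p' q"
proof -
  let ?X = "Poly_Mapping.keys p \<union> Poly_Mapping.keys p'"
  have *: "Poly_Mapping.keys (p + p') \<subseteq> ?X"
    by (rule Poly_Mapping.keys_add)
  show ?thesis
    by (subst (1 2 3) bilinear_extension_superset[of ?X _ "Poly_Mapping.keys q"])
      (use * in \<open>auto simp: lookup_add algebra_simps free.scale_left_distrib sum.distrib\<close>)
qed

lemma bilinear_extension_add_right:
  "bilinear_extension b p (q + q') = bilinear_extension b p q + bilinear_extension b p q'"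
proof -
  let ?Y = "Poly_Mapping.keys q \<union> Poly_Mapping.keys q'"
  have *: "Poly_Mapping.keys (q + q') \<subseteq> ?Y"
    by (rule Poly_Mapping.keys_add)
  show ?thesis
    by (subst (1 2 3) bilinear_extension_superset[of "Poly_Mapping.keys p" _ ?Y])
      (use * in \<open>auto simp: lookup_add algebra_simps free.scale_left_distrib sum.distrib\<close>)
qed

lemma bilinear_extension_scale_left:
  "bilinear_extension b (free_scale c p) q = free_scale c (bilinear_extension b p q)"
proof -
  have *: "Poly_Mapping.keys (free_scale c p) \<subseteq> Poly_Mapping.keys p"
    by (auto simp: in_keys_iff)
  show ?thesis
    by (subst (1 2) bilinear_extension_superset[of "Poly_Mapping.keys p" _ "Poly_Mapping.keys q"])
      (use * in \<open>auto simp: free.scale_sum_right mult.assoc\<close>)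
qed

lemma bilinear_extension_scale_right:
  "bilinear_extension b p (free_scale c q) = free_scale c (bilinear_extension b p q)"
proof -
  have *: "Poly_Mapping.keys (free_scale c q) \<subseteq> Poly_Mapping.keys q"
    by (auto simp: in_keys_iff)
  show ?thesis
    by (subst (1 2) bilinear_extension_superset[of "Poly_Mapping.keys p" _ "Poly_Mapping.keys q"])
      (use * in \<open>auto simp: free.scale_sum_right mult.left_commute\<close>)
qed

lemma bilinear_extension_zero [simp]:
  "bilinear_extension b 0 q = 0" "bilinear_extension b p 0 = 0"
  by (simp_all add: bilinear_extension_def)

lemma bilinear_extension_diff_left:
  "bilinear_extension b (p - p') q = bilinear_extension b p q - bilinear_extension b p' q"
  using bilinear_extension_add_left[of b "p - p'" p' q] by (simp add: algebra_simps)

lemma bilinear_extension_diff_right: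
  "bilinear_extension b p (q - q') = bilinear_extension b p q - bilinear_extension b p q'"
  using bilinear_extension_add_right[of b p "q - q'" q'] by (simp add: algebra_simps)

lemma free_sum_single: "p = (\<Sum>x\<in>Poly_Mapping.keys p. Poly_Mapping.single x (Poly_Mapping.lookup p x))"
  by (rule poly_mapping_eqI) (auto simp: lookup_sum lookup_single when_def in_keys_iff)

lemma free_induct [case_names zero single add]:
  fixes p :: "'x \<Rightarrow>\<^sub>0 'k::field"
  assumes "P 0"
    and "\<And>x c. x \<in> Poly_Mapping.keys p \<Longrightarrow> P (Poly_Mapping.single x c)"
    and "\<And>p q. P p \<Longrightarrow> P q \<Longrightarrow> P (p + q)"
  shows "P p"
proof -
  have "P (\<Sum>x\<in>X. Poly_Mapping.single x (Poly_Mapping.lookup p x))" if "finite X" "X \<subseteq> Poly_Mapping.keys p" for X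
    using that by (induction X rule: finite_induct) (auto intro: assms)
  from this[of "Poly_Mapping.keys p"] show ?thesis
    by (simp only: free_sum_single[of p, symmetric] finite_keys order_refl)
qed

lemma equiv_tensor_rel: "equiv UNIV (tensor_rel s)"
proof (rule equivI)
  show "refl (tensor_rel s)"
    by (auto simp: refl_on_def tensor_rel_def free.span_zero)
  show "sym (tensor_rel s)"
    unfolding sym_def tensor_rel_def by (simp, metis free.span_neg minus_diff_eq)
  show "trans (tensor_rel s)"
  proof (rule transI)
    fix p q r
    assume "(p, q) \<in> tensor_rel s" "(q, r) \<in> tensor_rel s"
    then have "(p - q) + (q - r) \<in> free.span (multilinear_relations s)"
      by (intro free.span_add) (simp_all add: tensor_rel_def)
    then show "(p, r) \<in> tensor_rel s"
      by (simp add: tensor_rel_def)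
  qed
qed simp

lemma tensor_class_eq_iff:
  "tensor_class s p = tensor_class s q \<longleftrightarrow> p - q \<in> free.span (multilinear_relations s)"
  unfolding tensor_class_def using eq_equiv_class_iff[OF equiv_tensor_rel] by (auto simp: tensor_rel_def)

lemma mem_tensor_class: "q \<in> tensor_class s p \<longleftrightarrow> tensor_class s q = tensor_class s p"
  using equiv_class_eq_iff[OF equiv_tensor_rel, of p q s] by (auto simp: tensor_class_def)

lemma carrier_tensor_power:
  "carrier (tensor_power s n) = {tensor_class s p | p. \<forall>ys\<in>Poly_Mapping.keys p. length ys = n}"
  by (auto simp: tensor_power_def quotient_def tensor_class_def)

lemma multilinear_relations_cases:
  assumes "r \<in> multilinear_relations s"
  obtains
    (add) xs a b ys where "r = Poly_Mapping.single (xs @ [a + b] @ ys) 1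
        - Poly_Mapping.single (xs @ [a] @ ys) 1 - Poly_Mapping.single (xs @ [b] @ ys) 1"
  | (scale) xs c a ys where "r = Poly_Mapping.single (xs @ [s c a] @ ys) 1
        - free_scale c (Poly_Mapping.single (xs @ [a] @ ys) 1)"
  using assms unfolding multilinear_relations_def by blast

lemma multilinear_relations_intros:
  "Poly_Mapping.single (xs @ [a + b] @ ys) 1
     - Poly_Mapping.single (xs @ [a] @ ys) 1 - Poly_Mapping.single (xs @ [b] @ ys) 1
     \<in> multilinear_relations s"
  "Poly_Mapping.single (xs @ [s c a] @ ys) 1 - free_scale c (Poly_Mapping.single (xs @ [a] @ ys) 1)
     \<in> multilinear_relations s"
  unfolding multilinear_relations_def by blast+

lemma class_op_welldefined:
  fixes b :: "'a::{ring,monoid_mult} list \<Rightarrow> 'a list \<Rightarrow> ('a list \<Rightarrow>\<^sub>0 'k::field)"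
  assumes L: "\<And>r zs. r \<in> multilinear_relations s \<Longrightarrow>
      bilinear_extension b r (Poly_Mapping.single zs 1) \<in> free.span (multilinear_relations s)"
    and R: "\<And>r zs. r \<in> multilinear_relations s \<Longrightarrow>
      bilinear_extension b (Poly_Mapping.single zs 1) r \<in> free.span (multilinear_relations s)"
  shows "(\<Union>p\<in>tensor_class s p0. \<Union>q\<in>tensor_class s q0. tensor_class s (bilinear_extension b p q)) =
    tensor_class s (bilinear_extension b p0 q0)"
proof -
  let ?N = "free.span (multilinear_relations s)"
  have single: "Poly_Mapping.single zs c = free_scale c (Poly_Mapping.single zs 1)"
    for zs :: "'a list" and c :: 'k
    by (rule poly_mapping_eqI) (simp add: lookup_single when_def)
  have L': "bilinear_extension b r q \<in> ?N" if "r \<in> multilinear_relations s" for r q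
  proof (induction q rule: free_induct)
    case (single zs c)
    show ?case
      by (subst \<open>\<And>zs c. Poly_Mapping.single zs c = _\<close>, subst bilinear_extension_scale_right)
        (intro free.span_scale L that)
  qed (auto simp: free.span_zero bilinear_extension_add_right intro: free.span_add)
  have R': "bilinear_extension b q r \<in> ?N" if "r \<in> multilinear_relations s" for r q
  proof (induction q rule: free_induct)
    case (single zs c)
    show ?case
      by (subst \<open>\<And>zs c. Poly_Mapping.single zs c = _\<close>, subst bilinear_extension_scale_left)
        (intro free.span_scale R that)
  qed (auto simp: free.span_zero bilinear_extension_add_left intro: free.span_add)
  have L'': "bilinear_extension b r q \<in> ?N" if "r \<in> ?N" for r q
    using that
    by (induction r rule: free.span_induct_alt)
      (auto simp: bilinear_extension_add_left bilinear_extension_scale_left free.span_zero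
        intro!: free.span_add free.span_scale L')
  have R'': "bilinear_extension b q r \<in> ?N" if "r \<in> ?N" for r q
    using that
    by (induction r rule: free.span_induct_alt)
      (auto simp: bilinear_extension_add_right bilinear_extension_scale_right free.span_zero
        intro!: free.span_add free.span_scale R')
  have "tensor_class s (bilinear_extension b p q) = tensor_class s (bilinear_extension b p0 q0)"
    if "p \<in> tensor_class s p0" "q \<in> tensor_class s q0" for p q
  proof -
    have "p - p0 \<in> ?N" "q - q0 \<in> ?N"
      using that by (auto simp: mem_tensor_class tensor_class_eq_iff)
    then have "bilinear_extension b (p - p0) q + bilinear_extension b p0 (q - q0) \<in> ?N"
      by (intro free.span_add L'' R'')
    then show ?thesis
      by (simp add: tensor_class_eq_iff bilinear_extension_diff_left bilinear_extension_diff_right)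
  qed
  moreover have "p0 \<in> tensor_class s p0" "q0 \<in> tensor_class s q0"
    by (simp_all add: mem_tensor_class)
  ultimately show ?thesis
    by blast
qed

lemma tensor_add_class [simp]:
  "tensor_add s (tensor_class s p) (tensor_class s q) = tensor_class s (p + q)"
proof -
  have "tensor_class s (p' + q') = tensor_class s (p + q)"
    if "p' \<in> tensor_class s p" "q' \<in> tensor_class s q" for p' q'
    using that free.span_add[of "p' - p" "multilinear_relations s" "q' - q"]
    by (auto simp: mem_tensor_class tensor_class_eq_iff algebra_simps)
  moreover have "p \<in> tensor_class s p" "q \<in> tensor_class s q"
    by (simp_all add: mem_tensor_class)
  ultimately show ?thesis
    unfolding tensor_add_def by blast
qed

lemma tensor_concat_class [simp]:
  "tensor_concat s (tensor_class s p) (tensor_class s q) = tensor_class s (free_concat p q)"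
  unfolding tensor_concat_def free_concat_def
proof (rule class_op_welldefined)
  fix r zs
  assume "r \<in> multilinear_relations s"
  then show "bilinear_extension (\<lambda>xs ys. Poly_Mapping.single (xs @ ys) 1) r (Poly_Mapping.single zs 1)
    \<in> free.span (multilinear_relations s)"
  proof (cases rule: multilinear_relations_cases)
    case (add xs a b ys)
    show ?thesis
      using multilinear_relations_intros(1)[of xs a b "ys @ zs" s]
      by (simp add: add bilinear_extension_diff_left free.span_base)
  next
    case (scale xs c a ys)
    show ?thesis
      using multilinear_relations_intros(2)[of xs s c a "ys @ zs"]
      by (simp add: scale bilinear_extension_diff_left bilinear_extension_scale_left free.span_base)
  qed
next
  fix r zs
  assume "r \<in> multilinear_relations s"
  then show "bilinear_extension (\<lambda>xs ys. Poly_Mapping.single (xs @ ys) 1) (Poly_Mapping.single zs 1) r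
    \<in> free.span (multilinear_relations s)"
  proof (cases rule: multilinear_relations_cases)
    case (add xs a b ys)
    show ?thesis
      using multilinear_relations_intros(1)[of "zs @ xs" a b ys s]
      by (simp add: add bilinear_extension_diff_right free.span_base)
  next
    case (scale xs c a ys)
    show ?thesis
      using multilinear_relations_intros(2)[of "zs @ xs" s c a ys]
      by (simp add: scale bilinear_extension_diff_right bilinear_extension_scale_right free.span_base)
  qed
qed

lemma length_split3:
  assumes "length zs = length (xs @ [a] @ ys)"
  obtains us z vs where "zs = us @ [z] @ vs" "length us = length xs" "length vs = length ys"
proof
  show "zs = take (length xs) zs @ [zs ! length xs] @ drop (Suc (length xs)) zs"
    using assms by (simp add: id_take_nth_drop)
qed (use assms in auto)

lemma tensor_mult_class [simp]:
  assumes "unital_algebra s"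
  shows "tensor_mult s (tensor_class s p) (tensor_class s q) = tensor_class s (free_mult p q)"
  unfolding tensor_mult_def free_mult_def
proof (rule class_op_welldefined)
  interpret unital_algebra s by fact
  fix r zs
  assume "r \<in> multilinear_relations s"
  then show "bilinear_extension (\<lambda>xs ys. if length xs = length ys
      then Poly_Mapping.single (map2 (*) xs ys) 1 else 0) r (Poly_Mapping.single zs 1)
    \<in> free.span (multilinear_relations s)"
  proof (cases rule: multilinear_relations_cases)
    case (add xs a b ys)
    show ?thesis
    proof (cases "length zs = length (xs @ [a] @ ys)")
      case True
      then obtain us z vs where "zs = us @ [z] @ vs" "length us = length xs" "length vs = length ys"
        by (rule length_split3)
      then show ?thesis
        using multilinear_relations_intros(1)[of "map2 (*) xs us" "a * z" "b * z" "map2 (*) ys vs" s]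
        by (simp add: add bilinear_extension_diff_left free.span_base distrib_right)
    qed (auto simp: add bilinear_extension_diff_left free.span_zero)
  next
    case (scale xs c a ys)
    show ?thesis
    proof (cases "length zs = length (xs @ [a] @ ys)")
      case True
      then obtain us z vs where "zs = us @ [z] @ vs" "length us = length xs" "length vs = length ys"
        by (rule length_split3)
      then show ?thesis
        using multilinear_relations_intros(2)[of "map2 (*) xs us" s c "a * z" "map2 (*) ys vs"]
        by (simp add: scale bilinear_extension_diff_left bilinear_extension_scale_left free.span_base
            scale_mult_left)
    qed (auto simp: scale bilinear_extension_diff_left bilinear_extension_scale_left free.span_zero)
  qed
next
  interpret unital_algebra s by fact
  fix r zs
  assume "r \<in> multilinear_relations s"
  then show "bilinear_extension (\<lambda>xs ys. if length xs = length ys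
      then Poly_Mapping.single (map2 (*) xs ys) 1 else 0) (Poly_Mapping.single zs 1) r
    \<in> free.span (multilinear_relations s)"
  proof (cases rule: multilinear_relations_cases)
    case (add xs a b ys)
    show ?thesis
    proof (cases "length zs = length (xs @ [a] @ ys)")
      case True
      then obtain us z vs where "zs = us @ [z] @ vs" "length us = length xs" "length vs = length ys"
        by (rule length_split3)
      then show ?thesis
        using multilinear_relations_intros(1)[of "map2 (*) us xs" "z * a" "z * b" "map2 (*) vs ys" s]
        by (simp add: add bilinear_extension_diff_right free.span_base distrib_left)
    qed (auto simp: add bilinear_extension_diff_right free.span_zero)
  next
    case (scale xs c a ys)
    show ?thesis
    proof (cases "length zs = length (xs @ [a] @ ys)")
      case True
      then obtain us z vs where "zs = us @ [z] @ vs" "length us = length xs" "length vs = length ys"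
        by (rule length_split3)
      then show ?thesis
        using multilinear_relations_intros(2)[of "map2 (*) us xs" s c "z * a" "map2 (*) vs ys"]
        by (simp add: scale bilinear_extension_diff_right bilinear_extension_scale_right free.span_base
            scale_mult_right)
    qed (auto simp: scale bilinear_extension_diff_right bilinear_extension_scale_right free.span_zero)
  qed
qed

lemma degree_bilinear_extension:
  assumes "\<And>x y z. x \<in> Poly_Mapping.keys p \<Longrightarrow> y \<in> Poly_Mapping.keys q \<Longrightarrow>
      z \<in> Poly_Mapping.keys (b x y) \<Longrightarrow> P z"
    and "z \<in> Poly_Mapping.keys (bilinear_extension b p q)"
  shows "P z"
proof (rule ccontr)
  assume "\<not> P z"
  then have "Poly_Mapping.lookup (b x y) z = 0"
    if "x \<in> Poly_Mapping.keys p" "y \<in> Poly_Mapping.keys q" for x y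
    using assms(1)[OF that, of z] by (auto simp: in_keys_iff)
  then have "Poly_Mapping.lookup (bilinear_extension b p q) z = 0"
    by (simp add: bilinear_extension_def lookup_sum)
  with assms(2) show False
    by (simp add: in_keys_iff)
qed

lemma free_mult_add:
  "free_mult (p + p') q = free_mult p q + free_mult p' q"
  "free_mult p (q + q') = free_mult p q + free_mult p q'"
  by (simp_all add: free_mult_def bilinear_extension_add_left bilinear_extension_add_right)

lemma free_mult_zero [simp]: "free_mult 0 q = 0" "free_mult p 0 = 0"
  by (simp_all add: free_mult_def)

lemma free_scale_single [simp]:
  "free_scale c (Poly_Mapping.single x d) = Poly_Mapping.single x (c * d)"
  by (rule poly_mapping_eqI) (simp add: lookup_single when_def)

lemma free_mult_single:
  "free_mult (Poly_Mapping.single xs c) (Poly_Mapping.single ys d) =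
    (if length xs = length ys then Poly_Mapping.single (map2 (*) xs ys) (c * d) else 0)"
  by (simp add: free_mult_def)

lemma map2_mult_assoc:
  fixes xs ys zs :: "'a::{ring,monoid_mult} list"
  shows "map2 (*) (map2 (*) xs ys) zs = map2 (*) xs (map2 (*) ys zs)"
  by (induction xs ys arbitrary: zs rule: list_induct2')
    (auto simp: mult.assoc split: list.splits, (case_tac zs; simp add: mult.assoc)+)

lemma free_mult_assoc: "free_mult (free_mult p q) r = free_mult p (free_mult q r)"
proof (induction p rule: free_induct)
  case (single xs c)
  show ?case
  proof (induction q rule: free_induct)
    case (single ys d)
    show ?case
      by (induction r rule: free_induct)
        (auto simp: free_mult_add free_mult_single map2_mult_assoc mult.assoc)
  qed (simp_all add: free_mult_add)
qed (simp_all add: free_mult_add)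

lemma map2_mult_replicate_one:
  fixes xs :: "'a::{ring,monoid_mult} list"
  shows "map2 (*) (replicate (length xs) 1) xs = xs" "map2 (*) xs (replicate (length xs) 1) = xs"
  by (induction xs) auto

lemma free_mult_one:
  assumes "\<forall>ys\<in>Poly_Mapping.keys p. length ys = n"
  shows "free_mult (Poly_Mapping.single (replicate n 1) 1) p = p"
    and "free_mult p (Poly_Mapping.single (replicate n 1) 1) = p"
proof -
  show "free_mult (Poly_Mapping.single (replicate n 1) 1) p = p"
    by (induction p rule: free_induct)
      (use assms in \<open>auto simp: free_mult_add free_mult_single map2_mult_replicate_one\<close>)
  show "free_mult p (Poly_Mapping.single (replicate n 1) 1) = p"
    by (induction p rule: free_induct)
      (use assms in \<open>auto simp: free_mult_add free_mult_single map2_mult_replicate_one\<close>)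
qed

theorem ring_tensor_power:
  fixes s :: "'k::field \<Rightarrow> 'a::{ring,monoid_mult} \<Rightarrow> 'a"
  assumes "unital_algebra s"
  shows "Ring.ring (tensor_power s n)"
proof -
  define F where "F = {p :: 'a list \<Rightarrow>\<^sub>0 'k. \<forall>ys\<in>Poly_Mapping.keys p. length ys = n}"
  note mult_class = tensor_mult_class[OF assms]
  have car: "carrier (tensor_power s n) = tensor_class s ` F"
    by (auto simp: carrier_tensor_power F_def)
  have ops: "mult (tensor_power s n) = tensor_mult s" "add (tensor_power s n) = tensor_add s"
    "\<one>\<^bsub>tensor_power s n\<^esub> = tensor_class s (Poly_Mapping.single (replicate n 1) 1)"
    "\<zero>\<^bsub>tensor_power s n\<^esub> = tensor_class s 0"
    by (simp_all add: tensor_power_def pure_tensor_def)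
  have F_add: "p + q \<in> F" if "p \<in> F" "q \<in> F" for p q
    using that Poly_Mapping.keys_add[of p q] unfolding F_def by blast
  have F_mult: "free_mult p q \<in> F" if "p \<in> F" "q \<in> F" for p q
  proof -
    have "length zs = n" if zs: "zs \<in> Poly_Mapping.keys (free_mult p q)" for zs
      by (rule degree_bilinear_extension[OF _ zs[unfolded free_mult_def]])
        (use \<open>p \<in> F\<close> \<open>q \<in> F\<close> in \<open>simp add: F_def split: if_splits\<close>)
    then show ?thesis
      by (simp add: F_def)
  qed
  have F_uminus: "- p \<in> F" if "p \<in> F" for p
    using that by (simp add: F_def in_keys_iff)
  have F_one: "Poly_Mapping.single (replicate n 1) 1 \<in> F" and F_zero: "0 \<in> F"
    by (simp_all add: F_def)
  have F_one_mult: "free_mult (Poly_Mapping.single (replicate n 1) 1) p = p"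
    "free_mult p (Poly_Mapping.single (replicate n 1) 1) = p" if "p \<in> F" for p
    using that free_mult_one[of p n] by (simp_all add: F_def)
  have "abelian_group (tensor_power s n)"
  proof (rule abelian_groupI)
    fix x assume "x \<in> carrier (tensor_power s n)"
    then obtain p where p: "p \<in> F" "x = tensor_class s p"
      unfolding car by blast
    then show "\<exists>y\<in>carrier (tensor_power s n). y \<oplus>\<^bsub>tensor_power s n\<^esub> x = \<zero>\<^bsub>tensor_power s n\<^esub>"
      unfolding car ops by (intro bexI[of _ "tensor_class s (- p)"] imageI F_uminus) simp_all
  qed (unfold car ops, auto intro: F_add F_zero simp: add.assoc add.commute add.left_commute)
  moreover have "Group.monoid (tensor_power s n)"
    by (rule monoidI; unfold car ops)
      (auto intro: F_mult F_one simp: mult_class free_mult_assoc F_one_mult)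
  ultimately show ?thesis
    by (rule ringI; unfold car ops) (auto simp: mult_class free_mult_add)
qed

lemma tensor_mult_pure_tensor:
  assumes "unital_algebra s" "length xs = length ys"
  shows "tensor_mult s (pure_tensor s xs) (pure_tensor s ys) = pure_tensor s (map2 (*) xs ys)"
  using assms by (simp add: pure_tensor_def free_mult_def)

lemma tensor_concat_pure_tensor:
  "tensor_concat s (pure_tensor s xs) (pure_tensor s ys) = pure_tensor s (xs @ ys)"
  by (simp add: pure_tensor_def free_concat_def)

lemma deconcat_pure_tensor:
  fixes s ys
  defines "word \<equiv> (\<lambda>zs n. if n = length zs then pure_tensor s zs else \<zero>\<^bsub>tensor_power s n\<^esub>)"
  shows "deconcat (word ys) (m, n) =
    (if m + n = length ys
     then tensor_concat s (word (take m ys) m) (word (drop m ys) n)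
     else \<zero>\<^bsub>tensor_power s (m + n)\<^esub>)"
  by (auto simp: deconcat_def word_def tensor_concat_pure_tensor)

end

theory Submission
  imports Defs
begin

text \<open>
  In degree \<open>(m, n, k)\<close> the twisting equation reads
  \<open>\<Phi>(m + n, k) (\<Phi>(m, n) \<otimes> 1) = \<Phi>(m, n + k) (1 \<otimes> \<Phi>(n, k))\<close>. Every family of units \<open>F\<^sub>n \<in> R\<^sup>\<otimes>\<^sup>n\<close>
  yields a solution \<open>\<Phi>(m, n) = F\<^sub>m\<^sub>+\<^sub>n (F\<^sub>m \<otimes> F\<^sub>n)\<^sup>-\<^sup>1\<close>, because both sides then become
  \<open>F\<^sub>m\<^sub>+\<^sub>n\<^sub>+\<^sub>k (F\<^sub>m \<otimes> F\<^sub>n \<otimes> F\<^sub>k)\<^sup>-\<^sup>1\<close>. The point is that every normalized solution is of this form for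
  a family \<open>F\<close> that depends on the row \<open>\<Phi>(1, \<cdot>)\<close> alone, namely
  \<open>F\<^sub>0 = 1\<close> and \<open>F\<^sub>n\<^sub>+\<^sub>1 = \<Phi>(1, n) (1 \<otimes> F\<^sub>n)\<close>. Indeed \<open>\<Phi>(m, n) (F\<^sub>m \<otimes> F\<^sub>n) = F\<^sub>m\<^sub>+\<^sub>n\<close> follows by
  induction on \<open>m\<close>: multiply the equation in degree \<open>(1, m, n)\<close> by \<open>1 \<otimes> F\<^sub>m \<otimes> F\<^sub>n\<close> from the right
  (\<open>twisting_imp_trivialises\<close>). Conversely the solution built from this \<open>F\<close> is normalized and has the
  prescribed first row (\<open>trivialises_imp_twisting\<close>, \<open>trivialises_boundary_values\<close>). So the conditions
  on \<open>\<Phi>\<close> amount to \<open>\<Phi>(m, n) (F\<^sub>m \<otimes> F\<^sub>n) = F\<^sub>m\<^sub>+\<^sub>n\<close> for all \<open>m\<close> and \<open>n\<close>, which has exactly one solution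
  since the \<open>F\<^sub>n\<close> are invertible.

  The argument only multiplies and juxtaposes tensors, never adds them; it is carried out for any
  sequence of monoids with an associative, unital and multiplicative juxtaposition, and then applied
  to the tensor powers.
\<close>

section \<open>Twisting elements of a tower of monoids\<close>

locale monoid_tower =
  fixes A :: "nat \<Rightarrow> ('b, 'z) monoid_scheme"
    and cat :: "'b \<Rightarrow> 'b \<Rightarrow> 'b" (infixr "\<boxtimes>" 75)
  assumes monoid [simp]: "Group.monoid (A n)"
    and cat_closed [simp]:
      "x \<in> carrier (A m) \<Longrightarrow> y \<in> carrier (A n) \<Longrightarrow> x \<boxtimes> y \<in> carrier (A (m + n))"
    and cat_mult:
      "x \<in> carrier (A m) \<Longrightarrow> x' \<in> carrier (A m) \<Longrightarrow> y \<in> carrier (A n) \<Longrightarrow> y' \<in> carrier (A n)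
        \<Longrightarrow> (x \<boxtimes> y) \<otimes>\<^bsub>A (m + n)\<^esub> (x' \<boxtimes> y') = (x \<otimes>\<^bsub>A m\<^esub> x') \<boxtimes> (y \<otimes>\<^bsub>A n\<^esub> y')"
    and cat_one: "\<one>\<^bsub>A m\<^esub> \<boxtimes> \<one>\<^bsub>A n\<^esub> = \<one>\<^bsub>A (m + n)\<^esub>"
    and cat_assoc:
      "x \<in> carrier (A m) \<Longrightarrow> y \<in> carrier (A n) \<Longrightarrow> z \<in> carrier (A k)
        \<Longrightarrow> (x \<boxtimes> y) \<boxtimes> z = x \<boxtimes> (y \<boxtimes> z)"
    and cat_unit [simp]:
      "x \<in> carrier (A n) \<Longrightarrow> \<one>\<^bsub>A 0\<^esub> \<boxtimes> x = x" "x \<in> carrier (A n) \<Longrightarrow> x \<boxtimes> \<one>\<^bsub>A 0\<^esub> = x"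
begin

lemma one_closed [simp]: "\<one>\<^bsub>A n\<^esub> \<in> carrier (A n)"
  by (simp add: monoid.one_closed)

lemma mult_closed [simp]:
  "x \<in> carrier (A n) \<Longrightarrow> y \<in> carrier (A n) \<Longrightarrow> x \<otimes>\<^bsub>A n\<^esub> y \<in> carrier (A n)"
  by (simp add: monoid.m_closed)

lemma mult_assoc:
  "x \<in> carrier (A n) \<Longrightarrow> y \<in> carrier (A n) \<Longrightarrow> z \<in> carrier (A n)
    \<Longrightarrow> (x \<otimes>\<^bsub>A n\<^esub> y) \<otimes>\<^bsub>A n\<^esub> z = x \<otimes>\<^bsub>A n\<^esub> (y \<otimes>\<^bsub>A n\<^esub> z)"
  by (simp add: monoid.m_assoc)

lemma mult_one [simp]:
  "x \<in> carrier (A n) \<Longrightarrow> \<one>\<^bsub>A n\<^esub> \<otimes>\<^bsub>A n\<^esub> x = x" "x \<in> carrier (A n) \<Longrightarrow> x \<otimes>\<^bsub>A n\<^esub> \<one>\<^bsub>A n\<^esub> = x"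
  by (simp_all add: monoid.l_one monoid.r_one)

lemma Units_closed [simp]: "u \<in> Units (A n) \<Longrightarrow> u \<in> carrier (A n)"
  by (simp add: Units_def)

lemma Units_right_cancel:
  assumes u: "u \<in> Units (A n)" and x: "x \<in> carrier (A n)" and y: "y \<in> carrier (A n)"
    and eq: "x \<otimes>\<^bsub>A n\<^esub> u = y \<otimes>\<^bsub>A n\<^esub> u"
  shows "x = y"
proof -
  obtain v where v: "v \<in> carrier (A n)" "u \<otimes>\<^bsub>A n\<^esub> v = \<one>\<^bsub>A n\<^esub>"
    using u unfolding Units_def by blast
  have "z = (z \<otimes>\<^bsub>A n\<^esub> u) \<otimes>\<^bsub>A n\<^esub> v" if "z \<in> carrier (A n)" for z
    using that u v by (simp add: mult_assoc)
  from this[OF x] this[OF y] show ?thesis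
    by (simp only: eq)
qed

lemma cat_Units [simp]:
  assumes "u \<in> Units (A m)" "v \<in> Units (A n)"
  shows "u \<boxtimes> v \<in> Units (A (m + n))"
proof -
  obtain u' v' where
    "u' \<in> carrier (A m)" "u \<otimes>\<^bsub>A m\<^esub> u' = \<one>\<^bsub>A m\<^esub>" "u' \<otimes>\<^bsub>A m\<^esub> u = \<one>\<^bsub>A m\<^esub>"
    "v' \<in> carrier (A n)" "v \<otimes>\<^bsub>A n\<^esub> v' = \<one>\<^bsub>A n\<^esub>" "v' \<otimes>\<^bsub>A n\<^esub> v = \<one>\<^bsub>A n\<^esub>"
    using assms unfolding Units_def by blast
  moreover have "u \<in> carrier (A m)" "v \<in> carrier (A n)"
    using assms by simp_all
  ultimately show ?thesis
    unfolding Units_def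
    by (simp del: Units_closed) (intro bexI[of _ "u' \<boxtimes> v'"]; simp del: Units_closed add: cat_mult cat_one)
qed

definition twisting :: "(nat \<Rightarrow> nat \<Rightarrow> 'b) \<Rightarrow> bool" where
  "twisting \<phi> \<longleftrightarrow> (\<forall>m n k.
     \<phi> (m + n) k \<otimes>\<^bsub>A (m + n + k)\<^esub> (\<phi> m n \<boxtimes> \<one>\<^bsub>A k\<^esub>) =
     \<phi> m (n + k) \<otimes>\<^bsub>A (m + n + k)\<^esub> (\<one>\<^bsub>A m\<^esub> \<boxtimes> \<phi> n k))"

text \<open>
  \<open>\<phi>\<close> is the coboundary \<open>F\<^sub>m\<^sub>+\<^sub>n (F\<^sub>m \<boxtimes> F\<^sub>n)\<^sup>-\<^sup>1\<close>, written without inverses so that both directions of the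
  comparison with the twisting equation are plain computations in the monoids.
\<close>

definition trivialises :: "(nat \<Rightarrow> 'b) \<Rightarrow> (nat \<Rightarrow> nat \<Rightarrow> 'b) \<Rightarrow> bool" where
  "trivialises F \<phi> \<longleftrightarrow> (\<forall>m n. \<phi> m n \<otimes>\<^bsub>A (m + n)\<^esub> (F m \<boxtimes> F n) = F (m + n))"

text \<open>
  \<open>g n\<close> stands for the component of the twisting element in bidegree \<open>(1, n)\<close>; the recursion is the
  coboundary condition in that bidegree, solved for \<open>F\<^sub>n\<^sub>+\<^sub>1\<close> with \<open>F\<^sub>1 = 1\<close>.
\<close>

primrec gauge :: "(nat \<Rightarrow> 'b) \<Rightarrow> nat \<Rightarrow> 'b" where
  "gauge g 0 = \<one>\<^bsub>A 0\<^esub>"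
| "gauge g (Suc n) = g n \<otimes>\<^bsub>A (Suc n)\<^esub> (\<one>\<^bsub>A 1\<^esub> \<boxtimes> gauge g n)"

lemma gauge_Units:
  assumes "\<And>n. g n \<in> Units (A (Suc n))"
  shows "gauge g n \<in> Units (A n)"
proof (induction n)
  case 0
  show ?case
    by (simp add: monoid.Units_one_closed)
next
  case (Suc n)
  have "\<one>\<^bsub>A 1\<^esub> \<boxtimes> gauge g n \<in> Units (A (Suc n))"
    using cat_Units[OF monoid.Units_one_closed[OF monoid] Suc, of 1] by simp
  then show ?case
    by (simp add: monoid.Units_m_closed assms)
qed

lemma trivialises_uniquely:
  assumes F: "\<And>n. F n \<in> Units (A n)"
  shows "\<exists>!\<phi>. (\<forall>m n. \<phi> m n \<in> Units (A (m + n))) \<and> trivialises F \<phi>"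
proof (rule ex1I)
  define \<phi> where "\<phi> = (\<lambda>m n. F (m + n) \<otimes>\<^bsub>A (m + n)\<^esub> inv\<^bsub>A (m + n)\<^esub> (F m \<boxtimes> F n))"
  show "(\<forall>m n. \<phi> m n \<in> Units (A (m + n))) \<and> trivialises F \<phi>"
    unfolding trivialises_def \<phi>_def
    by (auto simp: F monoid.Units_m_closed monoid.Units_inv_Units mult_assoc monoid.Units_l_inv)
next
  define \<psi> where "\<psi> = (\<lambda>m n. F (m + n) \<otimes>\<^bsub>A (m + n)\<^esub> inv\<^bsub>A (m + n)\<^esub> (F m \<boxtimes> F n))"
  fix \<phi>
  assume \<phi>: "(\<forall>m n. \<phi> m n \<in> Units (A (m + n))) \<and> trivialises F \<phi>"
  show "\<phi> = \<psi>"
  proof (intro ext)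
    fix m n
    have "\<phi> m n \<otimes>\<^bsub>A (m + n)\<^esub> (F m \<boxtimes> F n) = \<psi> m n \<otimes>\<^bsub>A (m + n)\<^esub> (F m \<boxtimes> F n)"
      using \<phi> unfolding trivialises_def \<psi>_def
      by (simp add: F monoid.Units_inv_Units mult_assoc monoid.Units_l_inv)
    then show "\<phi> m n = \<psi> m n"
      by (rule Units_right_cancel[rotated -1])
        (use \<phi> F in \<open>auto simp: \<psi>_def monoid.Units_inv_Units\<close>)
  qed
qed

text \<open>
  Since juxtaposition is multiplicative, a factor \<open>a \<boxtimes> b \<boxtimes> c\<close> on the right of either side of the
  twisting equation is absorbed by the inner \<open>\<phi>\<close>. With \<open>a\<close>, \<open>b\<close>, \<open>c\<close> taken from \<open>F\<close> this
  is how the twisting equation and \<open>trivialises F \<phi>\<close> are compared.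
\<close>

lemma twisting_times_cat:
  assumes \<phi>: "\<And>m n. \<phi> m n \<in> carrier (A (m + n))"
    and c: "a \<in> carrier (A m)" "b \<in> carrier (A n)" "c \<in> carrier (A k)"
  shows "(\<phi> (m + n) k \<otimes>\<^bsub>A (m + n + k)\<^esub> (\<phi> m n \<boxtimes> \<one>\<^bsub>A k\<^esub>)) \<otimes>\<^bsub>A (m + n + k)\<^esub> (a \<boxtimes> b \<boxtimes> c) =
      \<phi> (m + n) k \<otimes>\<^bsub>A (m + n + k)\<^esub> ((\<phi> m n \<otimes>\<^bsub>A (m + n)\<^esub> (a \<boxtimes> b)) \<boxtimes> c)"
    and "(\<phi> m (n + k) \<otimes>\<^bsub>A (m + n + k)\<^esub> (\<one>\<^bsub>A m\<^esub> \<boxtimes> \<phi> n k)) \<otimes>\<^bsub>A (m + n + k)\<^esub> (a \<boxtimes> b \<boxtimes> c) =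
      \<phi> m (n + k) \<otimes>\<^bsub>A (m + n + k)\<^esub> (a \<boxtimes> (\<phi> n k \<otimes>\<^bsub>A (n + k)\<^esub> (b \<boxtimes> c)))"
proof -
  have "a \<boxtimes> b \<boxtimes> c = (a \<boxtimes> b) \<boxtimes> c"
    using c by (simp add: cat_assoc)
  then show "(\<phi> (m + n) k \<otimes>\<^bsub>A (m + n + k)\<^esub> (\<phi> m n \<boxtimes> \<one>\<^bsub>A k\<^esub>)) \<otimes>\<^bsub>A (m + n + k)\<^esub> (a \<boxtimes> b \<boxtimes> c) =
      \<phi> (m + n) k \<otimes>\<^bsub>A (m + n + k)\<^esub> ((\<phi> m n \<otimes>\<^bsub>A (m + n)\<^esub> (a \<boxtimes> b)) \<boxtimes> c)"
    using c \<phi> by (simp add: mult_assoc cat_mult)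
  have "\<phi> m (n + k) \<in> carrier (A (m + (n + k)))" by (rule \<phi>)
  then show "(\<phi> m (n + k) \<otimes>\<^bsub>A (m + n + k)\<^esub> (\<one>\<^bsub>A m\<^esub> \<boxtimes> \<phi> n k)) \<otimes>\<^bsub>A (m + n + k)\<^esub> (a \<boxtimes> b \<boxtimes> c) =
      \<phi> m (n + k) \<otimes>\<^bsub>A (m + n + k)\<^esub> (a \<boxtimes> (\<phi> n k \<otimes>\<^bsub>A (n + k)\<^esub> (b \<boxtimes> c)))"
    using c \<phi>[of n k] unfolding add.assoc by (simp add: mult_assoc cat_mult)
qed

text \<open>
  Multiplied by the unit \<open>F m \<boxtimes> F n \<boxtimes> F k\<close>, both sides of the twisting equation collapse to
  \<open>F (m + n + k)\<close>.
\<close>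

lemma trivialises_imp_twisting:
  assumes F: "\<And>n. F n \<in> Units (A n)"
    and \<phi>: "\<And>m n. \<phi> m n \<in> carrier (A (m + n))"
    and triv: "trivialises F \<phi>"
  shows "twisting \<phi>"
  unfolding twisting_def
proof (intro allI)
  fix m n k
  let ?u = "F m \<boxtimes> F n \<boxtimes> F k"
  have triv': "\<phi> i j \<otimes>\<^bsub>A (i + j)\<^esub> (F i \<boxtimes> F j) = F (i + j)" for i j
    using triv by (simp add: trivialises_def)
  have Fc: "F i \<in> carrier (A i)" for i
    by (simp add: F)
  have \<phi>': "\<phi> m (n + k) \<in> carrier (A (m + n + k))"
    using \<phi>[of m "n + k"] by (simp add: add.assoc)
  have u: "?u \<in> Units (A (m + n + k))"
    using F by (simp add: add.assoc)
  have "(\<phi> (m + n) k \<otimes>\<^bsub>A (m + n + k)\<^esub> (\<phi> m n \<boxtimes> \<one>\<^bsub>A k\<^esub>)) \<otimes>\<^bsub>A (m + n + k)\<^esub> ?u = F (m + n + k)"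
    by (simp add: twisting_times_cat(1)[OF \<phi> Fc Fc Fc] triv')
  moreover have "(\<phi> m (n + k) \<otimes>\<^bsub>A (m + n + k)\<^esub> (\<one>\<^bsub>A m\<^esub> \<boxtimes> \<phi> n k)) \<otimes>\<^bsub>A (m + n + k)\<^esub> ?u
      = F (m + n + k)"
    using triv'[of m "n + k"] unfolding twisting_times_cat(2)[OF \<phi> Fc Fc Fc] triv'[of n k]
    by (simp add: add.assoc)
  moreover have "\<one>\<^bsub>A m\<^esub> \<boxtimes> \<phi> n k \<in> carrier (A (m + n + k))"
    using cat_closed[OF one_closed \<phi>] by (simp add: add.assoc)
  moreover have "\<phi> m n \<boxtimes> \<one>\<^bsub>A k\<^esub> \<in> carrier (A (m + n + k))"
    by (rule cat_closed[OF \<phi> one_closed])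
  ultimately show "\<phi> (m + n) k \<otimes>\<^bsub>A (m + n + k)\<^esub> (\<phi> m n \<boxtimes> \<one>\<^bsub>A k\<^esub>) =
      \<phi> m (n + k) \<otimes>\<^bsub>A (m + n + k)\<^esub> (\<one>\<^bsub>A m\<^esub> \<boxtimes> \<phi> n k)"
    using Units_right_cancel[OF u mult_closed[OF \<phi>] mult_closed[OF \<phi>']] by simp
qed

text \<open>
  The twisting equation in degree \<open>(1, m, n)\<close> expresses row \<open>m + 1\<close> of \<open>\<phi>\<close> through rows \<open>1\<close> and \<open>m\<close>,
  and the recursion of \<open>gauge\<close> is made so that the coboundary condition passes along.
\<close>

lemma twisting_imp_trivialises:
  assumes g: "\<And>n. g n \<in> Units (A (Suc n))"
    and \<phi>: "\<And>m n. \<phi> m n \<in> carrier (A (m + n))"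
    and tw: "twisting \<phi>" and zero: "\<And>n. \<phi> 0 n = \<one>\<^bsub>A n\<^esub>" and row: "\<And>n. \<phi> 1 n = g n"
  shows "trivialises (gauge g) \<phi>"
  unfolding trivialises_def
proof (intro allI)
  fix m n
  let ?F = "gauge g"
  have F: "?F i \<in> carrier (A i)" for i
    by (simp add: gauge_Units g)
  show "\<phi> m n \<otimes>\<^bsub>A (m + n)\<^esub> (?F m \<boxtimes> ?F n) = ?F (m + n)"
  proof (induction m)
    case 0
    show ?case
      using F[of n] by (simp add: zero)
  next
    case (Suc m)
    have "\<phi> (Suc m) n \<otimes>\<^bsub>A (Suc m + n)\<^esub> (?F (Suc m) \<boxtimes> ?F n) =
        \<phi> (1 + m) n \<otimes>\<^bsub>A (1 + m + n)\<^esub> ((\<phi> 1 m \<otimes>\<^bsub>A (1 + m)\<^esub> (\<one>\<^bsub>A 1\<^esub> \<boxtimes> ?F m)) \<boxtimes> ?F n)"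
      by (simp add: row[simplified])
    also have "\<dots> = (\<phi> (1 + m) n \<otimes>\<^bsub>A (1 + m + n)\<^esub> (\<phi> 1 m \<boxtimes> \<one>\<^bsub>A n\<^esub>)) \<otimes>\<^bsub>A (1 + m + n)\<^esub>
        (\<one>\<^bsub>A 1\<^esub> \<boxtimes> ?F m \<boxtimes> ?F n)"
      by (rule twisting_times_cat(1)[symmetric, OF \<phi> one_closed F F])
    also have "\<dots> = (\<phi> 1 (m + n) \<otimes>\<^bsub>A (1 + m + n)\<^esub> (\<one>\<^bsub>A 1\<^esub> \<boxtimes> \<phi> m n)) \<otimes>\<^bsub>A (1 + m + n)\<^esub>
        (\<one>\<^bsub>A 1\<^esub> \<boxtimes> ?F m \<boxtimes> ?F n)"
      using tw by (simp only: twisting_def)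
    also have "\<dots> = \<phi> 1 (m + n) \<otimes>\<^bsub>A (1 + m + n)\<^esub>
        (\<one>\<^bsub>A 1\<^esub> \<boxtimes> (\<phi> m n \<otimes>\<^bsub>A (m + n)\<^esub> (?F m \<boxtimes> ?F n)))"
      by (rule twisting_times_cat(2)[OF \<phi> one_closed F F])
    also have "\<dots> = ?F (Suc m + n)"
      by (simp only: Suc.IH row) simp
    finally show ?case .
  qed
qed

text \<open>
  The gauge is trivial in degrees \<open>0\<close> and \<open>1\<close>, so in bidegrees \<open>(0, n)\<close>, \<open>(n, 0)\<close> and \<open>(1, n)\<close> the
  coboundary condition determines \<open>\<phi>\<close> by cancelling a single unit. Degree \<open>1\<close> uses \<open>g 0 = 1\<close>,
  which the normalization forces.
\<close>

lemma trivialises_boundary_values: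
  assumes g: "\<And>n. g n \<in> Units (A (Suc n))" and g0: "g 0 = \<one>\<^bsub>A 1\<^esub>"
    and \<phi>: "\<And>m n. \<phi> m n \<in> carrier (A (m + n))"
    and triv: "trivialises (gauge g) \<phi>"
  shows "\<phi> 0 n = \<one>\<^bsub>A n\<^esub>" and "\<phi> n 0 = \<one>\<^bsub>A n\<^esub>" and "\<phi> 1 n = g n"
proof -
  let ?F = "gauge g"
  have F: "?F i \<in> Units (A i)" for i
    by (simp add: gauge_Units g)
  have Fc: "?F i \<in> carrier (A i)" for i
    by (simp add: F)
  have triv': "\<phi> i j \<otimes>\<^bsub>A (i + j)\<^esub> (?F i \<boxtimes> ?F j) = ?F (i + j)" for i j
    using triv by (simp add: trivialises_def)
  show "\<phi> 0 n = \<one>\<^bsub>A n\<^esub>"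
    by (rule Units_right_cancel[OF F[of n]])
      (use triv'[of 0 n] Fc[of n] \<phi>[of 0 n] in simp_all)
  show "\<phi> n 0 = \<one>\<^bsub>A n\<^esub>"
    by (rule Units_right_cancel[OF F[of n]])
      (use triv'[of n 0] Fc[of n] \<phi>[of n 0] in simp_all)
  have gc: "g n \<in> carrier (A (Suc n))" by (simp add: g)
  have F1: "?F 1 = \<one>\<^bsub>A 1\<^esub>"
    by (simp add: g0 cat_one)
  have u: "\<one>\<^bsub>A 1\<^esub> \<boxtimes> ?F n \<in> Units (A (Suc n))"
    using cat_Units[OF F F, of 1 n, unfolded F1] by simp
  show "\<phi> 1 n = g n"
    by (rule Units_right_cancel[OF u]) (use triv'[of 1 n, unfolded F1] \<phi>[of 1 n] gc in simp_all)
qed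

theorem ex1_twisting:
  assumes g: "\<And>n. g n \<in> Units (A (Suc n))" and g0: "g 0 = \<one>\<^bsub>A 1\<^esub>"
  shows "\<exists>!\<phi>. (\<forall>m n. \<phi> m n \<in> Units (A (m + n))) \<and>
    (\<forall>n. \<phi> 0 n = \<one>\<^bsub>A n\<^esub>) \<and> (\<forall>n. \<phi> n 0 = \<one>\<^bsub>A n\<^esub>) \<and> twisting \<phi> \<and> (\<forall>n. \<phi> 1 n = g n)"
proof -
  have "trivialises (gauge g) \<phi> \<longleftrightarrow>
    (\<forall>n. \<phi> 0 n = \<one>\<^bsub>A n\<^esub>) \<and> (\<forall>n. \<phi> n 0 = \<one>\<^bsub>A n\<^esub>) \<and> twisting \<phi> \<and> (\<forall>n. \<phi> 1 n = g n)"
    if "\<forall>m n. \<phi> m n \<in> Units (A (m + n))" for \<phi>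
  proof -
    have \<phi>: "\<And>m n. \<phi> m n \<in> carrier (A (m + n))"
      using that by simp
    show ?thesis
    proof
      assume t: "trivialises (gauge g) \<phi>"
      show "(\<forall>n. \<phi> 0 n = \<one>\<^bsub>A n\<^esub>) \<and> (\<forall>n. \<phi> n 0 = \<one>\<^bsub>A n\<^esub>) \<and> twisting \<phi> \<and> (\<forall>n. \<phi> 1 n = g n)"
        by (intro conjI allI trivialises_boundary_values[OF g g0 \<phi> t]
            trivialises_imp_twisting[OF gauge_Units[OF g] \<phi> t])
    next
      assume "(\<forall>n. \<phi> 0 n = \<one>\<^bsub>A n\<^esub>) \<and> (\<forall>n. \<phi> n 0 = \<one>\<^bsub>A n\<^esub>) \<and> twisting \<phi> \<and> (\<forall>n. \<phi> 1 n = g n)"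
      then show "trivialises (gauge g) \<phi>"
        using twisting_imp_trivialises[OF g \<phi>] by blast
    qed
  qed
  then show ?thesis
    using trivialises_uniquely[of "gauge g", OF gauge_Units[OF g]] by (simp cong: conj_cong)
qed

end


section \<open>Tensor powers form a tower of monoids\<close>

lemma free_concat_add:
  "free_concat (p + p') q = free_concat p q + free_concat p' q"
  "free_concat p (q + q') = free_concat p q + free_concat p q'"
  by (simp_all add: free_concat_def bilinear_extension_add_left bilinear_extension_add_right)

lemma free_concat_zero [simp]: "free_concat 0 q = 0" "free_concat p 0 = 0"
  by (simp_all add: free_concat_def)

lemma free_concat_single [simp]:
  "free_concat (Poly_Mapping.single xs c) (Poly_Mapping.single ys d) =
    Poly_Mapping.single (xs @ ys) (c * d)"
  by (simp add: free_concat_def)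

lemma free_concat_assoc: "free_concat (free_concat p q) r = free_concat p (free_concat q r)"
proof (induction p rule: free_induct)
  case (single xs c)
  show ?case
  proof (induction q rule: free_induct)
    case (single ys d)
    show ?case
      by (induction r rule: free_induct) (simp_all add: free_concat_add mult.assoc)
  qed (simp_all add: free_concat_add)
qed (simp_all add: free_concat_add)

lemma free_concat_Nil [simp]:
  "free_concat (Poly_Mapping.single [] 1) p = p" "free_concat p (Poly_Mapping.single [] 1) = p"
proof -
  show "free_concat (Poly_Mapping.single [] 1) p = p"
    by (induction p rule: free_induct) (simp_all add: free_concat_add)
  show "free_concat p (Poly_Mapping.single [] 1) = p"
    by (induction p rule: free_induct) (simp_all add: free_concat_add)
qed

lemma length_keys_free_concat:
  assumes "\<forall>xs\<in>Poly_Mapping.keys p. length xs = m" "\<forall>ys\<in>Poly_Mapping.keys q. length ys = n"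
    and "zs \<in> Poly_Mapping.keys (free_concat p q)"
  shows "length zs = m + n"
  by (rule degree_bilinear_extension[OF _ assms(3)[unfolded free_concat_def]])
    (use assms(1,2) in simp)

text \<open>
  Homogeneity is essential: for words of unequal lengths \<open>free_mult\<close> vanishes on the factors but may
  be nonzero on concatenations whose total lengths happen to agree.
\<close>

lemma free_mult_concat:
  assumes "\<forall>xs\<in>Poly_Mapping.keys p. length xs = m" "\<forall>xs\<in>Poly_Mapping.keys p'. length xs = m"
    and "\<forall>ys\<in>Poly_Mapping.keys q. length ys = n" "\<forall>ys\<in>Poly_Mapping.keys q'. length ys = n"
  shows "free_mult (free_concat p q) (free_concat p' q') =
    free_concat (free_mult p p') (free_mult q q')"
proof (induction p rule: free_induct)
  case (single xs c)
  note xs = single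
  show ?case
  proof (induction p' rule: free_induct)
    case (single xs' c')
    note xs' = single
    show ?case
    proof (induction q rule: free_induct)
      case (single ys d)
      note ys = single
      show ?case
      proof (induction q' rule: free_induct)
        case (single ys' d')
        show ?case
          using assms xs xs' ys single by (simp add: free_mult_single mult_ac)
      qed (simp_all add: free_concat_add free_mult_add)
    qed (simp_all add: free_concat_add free_mult_add)
  qed (simp_all add: free_concat_add free_mult_add)
qed (simp_all add: free_concat_add free_mult_add)

lemma tensor_power_simps [simp]:
  "x \<otimes>\<^bsub>tensor_power s n\<^esub> y = tensor_mult s x y"
  "\<one>\<^bsub>tensor_power s n\<^esub> = tensor_class s (Poly_Mapping.single (replicate n 1) 1)"
  by (simp_all add: tensor_power_def pure_tensor_def)

lemma monoid_tower_tensor_power: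
  assumes "unital_algebra s"
  shows "monoid_tower (tensor_power s) (tensor_concat s)"
proof (rule monoid_tower.intro)
  note mult_class = tensor_mult_class[OF assms]
  show "Group.monoid (tensor_power s n)" for n
    using ring_tensor_power[OF assms, of n] by (simp add: Ring.ring_def)
  show "tensor_concat s x y \<in> carrier (tensor_power s (m + n))"
    if "x \<in> carrier (tensor_power s m)" "y \<in> carrier (tensor_power s n)" for x y m n
    using that length_keys_free_concat[where m = m and n = n]
    by (fastforce simp: carrier_tensor_power)
  show "tensor_concat s x y \<otimes>\<^bsub>tensor_power s (m + n)\<^esub> tensor_concat s x' y' =
      tensor_concat s (x \<otimes>\<^bsub>tensor_power s m\<^esub> x') (y \<otimes>\<^bsub>tensor_power s n\<^esub> y')"
    if "x \<in> carrier (tensor_power s m)" "x' \<in> carrier (tensor_power s m)"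
      "y \<in> carrier (tensor_power s n)" "y' \<in> carrier (tensor_power s n)" for x x' y y' m n
    using that
    by (clarsimp simp: carrier_tensor_power mult_class)
      (rule arg_cong[where f = "tensor_class s"], rule free_mult_concat; assumption)
  show "tensor_concat s \<one>\<^bsub>tensor_power s m\<^esub> \<one>\<^bsub>tensor_power s n\<^esub> = \<one>\<^bsub>tensor_power s (m + n)\<^esub>" for m n
    by (simp add: replicate_add)
qed (auto simp: carrier_tensor_power free_concat_assoc)


section \<open>The tensor bialgebra\<close>

lemma ring_prod_simps [simp]:
  "x \<in> carrier (ring_prod A) \<longleftrightarrow> (\<forall>i. x i \<in> carrier (A i))"
  "(x \<otimes>\<^bsub>ring_prod A\<^esub> y) = (\<lambda>i. x i \<otimes>\<^bsub>A i\<^esub> y i)"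
  "\<one>\<^bsub>ring_prod A\<^esub> = (\<lambda>i. \<one>\<^bsub>A i\<^esub>)"
  by (simp_all add: ring_prod_def)

lemma Units_ring_prod: "x \<in> Units (ring_prod A) \<longleftrightarrow> (\<forall>i. x i \<in> Units (A i))"
proof
  assume "x \<in> Units (ring_prod A)"
  then show "\<forall>i. x i \<in> Units (A i)"
    by (auto simp: Units_def fun_eq_iff)
next
  assume x: "\<forall>i. x i \<in> Units (A i)"
  then obtain y where "\<forall>i. y i \<in> carrier (A i) \<and> y i \<otimes>\<^bsub>A i\<^esub> x i = \<one>\<^bsub>A i\<^esub> \<and> x i \<otimes>\<^bsub>A i\<^esub> y i = \<one>\<^bsub>A i\<^esub>"
    unfolding Units_def mem_Collect_eq Bex_def by metis
  with x show "x \<in> Units (ring_prod A)"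
    by (auto simp: Units_def intro!: bexI[of _ y])
qed

theorem theorem1:
  fixes scale :: "'k::field \<Rightarrow> 'a::{ring,monoid_mult} \<Rightarrow> 'a"
    and \<Phi>1 :: "nat \<Rightarrow> ('a, 'k) tensor"
  assumes "finite_dimensional_unital_algebra scale"
    and "\<And>k. k \<ge> 1 \<Longrightarrow> \<Phi>1 k \<in> Units (tensor_power scale (1 + k))"
  shows "\<exists>!\<Phi>. \<Phi> \<in> Units (tensor_bialgebra2 scale) \<and> normalized scale \<Phi> \<and>
    twisting_equation scale \<Phi> \<and> (\<forall>k\<ge>1. proj2 1 k \<Phi> = \<Phi>1 k)"
proof -
  interpret monoid_tower "tensor_power scale" "tensor_concat scale"
    by (rule monoid_tower_tensor_power)
      (use assms(1) in \<open>simp add: finite_dimensional_unital_algebra_def\<close>)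
  let ?A = "tensor_power scale"
  \<comment> \<open>The family prescribes the degrees \<open>k \<ge> 1\<close> only; in degree \<open>0\<close> the normalization dictates the value.\<close>
  define g where "g = \<Phi>1(0 := \<one>\<^bsub>?A 1\<^esub>)"
  have g: "g n \<in> Units (?A (Suc n))" for n
    using assms(2)[of n] monoid.Units_one_closed[OF monoid, of 1] by (cases "n = 0") (simp_all add: g_def)
  define P where "P = (\<lambda>\<phi>. (\<forall>m n. \<phi> m n \<in> Units (?A (m + n))) \<and>
    (\<forall>n. \<phi> 0 n = \<one>\<^bsub>?A n\<^esub>) \<and> (\<forall>n. \<phi> n 0 = \<one>\<^bsub>?A n\<^esub>) \<and> twisting \<phi> \<and> (\<forall>n. \<phi> 1 n = g n))"
  have "\<exists>!\<phi>. P \<phi>"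
    unfolding P_def by (rule ex1_twisting[OF g]) (simp add: g_def)
  \<comment> \<open>The conditions in the bialgebra, read componentwise.\<close>
  moreover have "\<Phi> \<in> Units (tensor_bialgebra2 scale) \<and> normalized scale \<Phi> \<and>
      twisting_equation scale \<Phi> \<and> (\<forall>k\<ge>1. proj2 1 k \<Phi> = \<Phi>1 k) \<longleftrightarrow> P (curry \<Phi>)" for \<Phi>
  proof -
    have U: "\<Phi> \<in> Units (tensor_bialgebra2 scale) \<longleftrightarrow> (\<forall>m n. curry \<Phi> m n \<in> Units (?A (m + n)))"
      by (auto simp: tensor_bialgebra2_def Units_ring_prod)
    have N: "normalized scale \<Phi> \<longleftrightarrow>
        (\<forall>n. curry \<Phi> 0 n = \<one>\<^bsub>?A n\<^esub>) \<and> (\<forall>n. curry \<Phi> n 0 = \<one>\<^bsub>?A n\<^esub>)"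
      by (simp add: normalized_def tensor_bialgebra_def counit_id_def id_counit_def counit_def fun_eq_iff)
    have T: "twisting_equation scale \<Phi> \<longleftrightarrow> twisting (curry \<Phi>)"
      by (simp add: twisting_equation_def twisting_def tensor_bialgebra3_def tensor_bialgebra_def
          deconcat_id_def id_deconcat_def deconcat_def leg12_def leg23_def fun_eq_iff)
    have R: "(\<forall>k\<ge>1. proj2 1 k \<Phi> = \<Phi>1 k) \<longleftrightarrow> (\<forall>n. curry \<Phi> 1 n = g n)"
      if "\<forall>n. curry \<Phi> n 0 = \<one>\<^bsub>?A n\<^esub>"
      using that[rule_format, of 1] by (auto simp: proj2_def g_def)
    show ?thesis
      unfolding P_def using U N T R by blast
  qed
  ultimately show ?thesis
  proof (simp only:, elim ex1E)
    fix \<phi>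
    assume "P \<phi>" and unique: "\<forall>\<psi>. P \<psi> \<longrightarrow> \<psi> = \<phi>"
    then show "\<exists>!\<Phi>. P (curry \<Phi>)"
      by (intro ex1I[of _ "case_prod \<phi>"]) (auto simp: fun_eq_iff)
  qed
qed

end
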